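(* Let $\mathcal{M}$ be a von Neumann algebra with a faithful normal tracial state $\tau$. Then $d_{MT}(P,Q)\leq d_{KK}(P,Q)$ for all subalgebras $P,Q$ of $\mathcal{M}$.
   Context: $\|x\|_\tau=\tau(x^*x)^{1/2}$ for $x\in\mathcal{M}$. $B_1(P)$ denotes the closed unit ball of a subalgebra $P$ with respect to the operator norm. The Kadison-Kastler distance $d_{KK}(P,Q)$ is the Hausdorff distance between $B_1(P)$ and $B_1(Q)$ with respect to the operator norm: $d_{KK}(P,Q)=\max\{\sup_{x\in B_1(P)}\inf_{y\in B_1(Q)}\|x-y\|,\ \sup_{y\in B_1(Q)}\inf_{x\in B_1(P)}\|x-y\|\}$. The Mashood-Taylor distance $d_{MT}(P,Q)$ is given by the same formula with $\|x-y\|$ replaced by $\|x-y\|_\tau$ (the unit balls still being operator-norm unit balls). *)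

theory Defs
  imports "HOL-Analysis.Analysis"
begin

text \<open>
  Complex Hilbert spaces. The sesquilinear form is conjugate linear in its first argument; its real
  part is the inner product of the underlying real Hilbert space, so that the norm
  \<open>norm x = sqrt (x \<bullet> x)\<close> and the topology are those of \<^class>\<open>real_inner\<close>.
\<close>

class complex_inner = real_inner +
  fixes scaleC :: "complex \<Rightarrow> 'a \<Rightarrow> 'a" (infixr \<open>*\<^sub>C\<close> 75)
    and cinner :: "'a \<Rightarrow> 'a \<Rightarrow> complex"
  assumes scaleC_add_right: "c *\<^sub>C (x + y) = c *\<^sub>C x + c *\<^sub>C y"
    and scaleC_add_left: "(c + d) *\<^sub>C x = c *\<^sub>C x + d *\<^sub>C x"
    and scaleC_scaleC: "c *\<^sub>C d *\<^sub>C x = (c * d) *\<^sub>C x"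
    and scaleC_of_real: "complex_of_real r *\<^sub>C x = r *\<^sub>R x"
    and cinner_commute: "cinner x y = cnj (cinner y x)"
    and cinner_add_right: "cinner x (y + z) = cinner x y + cinner x z"
    and cinner_scaleC_right: "cinner x (c *\<^sub>C y) = c * cinner x y"
    and Re_cinner: "Re (cinner x y) = x \<bullet> y"

class chilbert_space = complex_inner + complete_space

lemma norm_scaleC: "norm (c *\<^sub>C x) = cmod c * norm (x :: 'a :: complex_inner)"
proof -
  have "cinner (c *\<^sub>C x) y = cnj c * cinner x y" for y
    by (subst (1 2) cinner_commute) (simp add: cinner_scaleC_right)
  hence "cinner (c *\<^sub>C x) (c *\<^sub>C x) = of_real ((cmod c)\<^sup>2) * cinner x x"
    by (simp add: cinner_scaleC_right mult.assoc [symmetric] complex_norm_square [symmetric])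
  hence "(c *\<^sub>C x) \<bullet> (c *\<^sub>C x) = (cmod c)\<^sup>2 * (x \<bullet> x)"
    by (simp flip: Re_cinner)
  thus ?thesis
    by (simp add: norm_eq_sqrt_inner real_sqrt_mult)
qed

lemma bounded_linear_scaleC: "bounded_linear (\<lambda>x :: 'a :: complex_inner. c *\<^sub>C x)"
proof (rule bounded_linear_intro)
  fix r :: real and x :: 'a
  show "c *\<^sub>C r *\<^sub>R x = r *\<^sub>R c *\<^sub>C x"
    by (simp add: scaleC_scaleC mult.commute flip: scaleC_of_real)
  show "norm (c *\<^sub>C x) \<le> norm x * cmod c"
    by (simp add: norm_scaleC)
qed (rule scaleC_add_right)

text \<open>
  Operators on \<open>'h\<close> are elements of the type \<open>'h \<Rightarrow>\<^sub>L 'h\<close> of bounded real-linear maps, whose norm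
  is the operator norm; \<open>cblinfuns\<close> is the algebra B(H) of the complex-linear ones.
\<close>

definition cblinfuns :: "('h::chilbert_space \<Rightarrow>\<^sub>L 'h) set" where
  "cblinfuns = {T. \<forall>c x. blinfun_apply T (c *\<^sub>C x) = c *\<^sub>C blinfun_apply T x}"

lift_definition scaleC_op :: "complex \<Rightarrow> ('h::chilbert_space \<Rightarrow>\<^sub>L 'h) \<Rightarrow> ('h \<Rightarrow>\<^sub>L 'h)"
  is "\<lambda>c T x. c *\<^sub>C T x"
  by (rule bounded_linear_compose [OF bounded_linear_scaleC])

text \<open>On B(H) the description is proper, by the Riesz representation theorem.\<close>

definition adj :: "('h::chilbert_space \<Rightarrow>\<^sub>L 'h) \<Rightarrow> ('h \<Rightarrow>\<^sub>L 'h)" where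
  "adj T = (THE S. \<forall>x y. cinner (blinfun_apply S x) y = cinner x (blinfun_apply T y))"

definition positive_op :: "('h::chilbert_space \<Rightarrow>\<^sub>L 'h) \<Rightarrow> bool" where
  "positive_op T \<longleftrightarrow> T \<in> cblinfuns \<and> (\<forall>x. cinner x (blinfun_apply T x) \<in> \<real>\<^sub>\<ge>\<^sub>0)"

definition le_op :: "('h::chilbert_space \<Rightarrow>\<^sub>L 'h) \<Rightarrow> ('h \<Rightarrow>\<^sub>L 'h) \<Rightarrow> bool" where
  "le_op S T \<longleftrightarrow> positive_op (T - S)"

definition is_subalgebra :: "('h::chilbert_space \<Rightarrow>\<^sub>L 'h) set \<Rightarrow> ('h \<Rightarrow>\<^sub>L 'h) set \<Rightarrow> bool" where
  "is_subalgebra P M \<longleftrightarrow> P \<subseteq> M \<and> 0 \<in> P \<and>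
     (\<forall>S\<in>P. \<forall>T\<in>P. S + T \<in> P \<and> S o\<^sub>L T \<in> P) \<and> (\<forall>c. \<forall>T\<in>P. scaleC_op c T \<in> P)"

definition von_neumann_algebra :: "('h::chilbert_space \<Rightarrow>\<^sub>L 'h) set \<Rightarrow> bool" where
  "von_neumann_algebra M \<longleftrightarrow> is_subalgebra M cblinfuns \<and> id_blinfun \<in> M \<and>
     (\<forall>T\<in>M. adj T \<in> M) \<and> closedin strong_operator_topology M"

definition state_on ::
  "('h::chilbert_space \<Rightarrow>\<^sub>L 'h) set \<Rightarrow> (('h \<Rightarrow>\<^sub>L 'h) \<Rightarrow> complex) \<Rightarrow> bool" where
  "state_on M \<phi> \<longleftrightarrow>
     (\<forall>S\<in>M. \<forall>T\<in>M. \<phi> (S + T) = \<phi> S + \<phi> T) \<and>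
     (\<forall>c. \<forall>T\<in>M. \<phi> (scaleC_op c T) = c * \<phi> T) \<and>
     (\<forall>T\<in>M. positive_op T \<longrightarrow> \<phi> T \<in> \<real>\<^sub>\<ge>\<^sub>0) \<and>
     \<phi> id_blinfun = 1"

definition faithful_on ::
  "('h::chilbert_space \<Rightarrow>\<^sub>L 'h) set \<Rightarrow> (('h \<Rightarrow>\<^sub>L 'h) \<Rightarrow> complex) \<Rightarrow> bool" where
  "faithful_on M \<phi> \<longleftrightarrow> (\<forall>T\<in>M. positive_op T \<longrightarrow> \<phi> T = 0 \<longrightarrow> T = 0)"

definition tracial_on ::
  "('h::chilbert_space \<Rightarrow>\<^sub>L 'h) set \<Rightarrow> (('h \<Rightarrow>\<^sub>L 'h) \<Rightarrow> complex) \<Rightarrow> bool" where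
  "tracial_on M \<phi> \<longleftrightarrow> (\<forall>S\<in>M. \<forall>T\<in>M. \<phi> (S o\<^sub>L T) = \<phi> (T o\<^sub>L S))"

text \<open>
  Normality: \<open>\<phi>\<close> preserves suprema of bounded increasing nets of self-adjoint elements, here given
  as upward directed sets \<open>D\<close> with least upper bound \<open>s\<close> in the self-adjoint part of \<open>M\<close>.
\<close>

definition self_adjoint_part :: "('h::chilbert_space \<Rightarrow>\<^sub>L 'h) set \<Rightarrow> ('h \<Rightarrow>\<^sub>L 'h) set" where
  "self_adjoint_part M = {T \<in> M. adj T = T}"

definition is_lub_op ::
  "('h::chilbert_space \<Rightarrow>\<^sub>L 'h) set \<Rightarrow> ('h \<Rightarrow>\<^sub>L 'h) set \<Rightarrow> ('h \<Rightarrow>\<^sub>L 'h) \<Rightarrow> bool" where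
  "is_lub_op M D s \<longleftrightarrow> s \<in> self_adjoint_part M \<and> (\<forall>T\<in>D. le_op T s) \<and>
     (\<forall>u \<in> self_adjoint_part M. (\<forall>T\<in>D. le_op T u) \<longrightarrow> le_op s u)"

definition normal_on ::
  "('h::chilbert_space \<Rightarrow>\<^sub>L 'h) set \<Rightarrow> (('h \<Rightarrow>\<^sub>L 'h) \<Rightarrow> complex) \<Rightarrow> bool" where
  "normal_on M \<phi> \<longleftrightarrow>
     (\<forall>D s. D \<noteq> {} \<longrightarrow> D \<subseteq> self_adjoint_part M \<longrightarrow>
        (\<forall>S\<in>D. \<forall>T\<in>D. \<exists>U\<in>D. le_op S U \<and> le_op T U) \<longrightarrow>
        is_lub_op M D s \<longrightarrow> Re (\<phi> s) = (SUP T\<in>D. Re (\<phi> T)))"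

definition tau_norm ::
  "(('h::chilbert_space \<Rightarrow>\<^sub>L 'h) \<Rightarrow> complex) \<Rightarrow> ('h \<Rightarrow>\<^sub>L 'h) \<Rightarrow> real" where
  "tau_norm \<tau> x = sqrt (Re (\<tau> (adj x o\<^sub>L x)))"

definition unit_ball :: "('h::chilbert_space \<Rightarrow>\<^sub>L 'h) set \<Rightarrow> ('h \<Rightarrow>\<^sub>L 'h) set" where
  "unit_ball P = {x \<in> P. norm x \<le> 1}"

definition d_KK :: "('h::chilbert_space \<Rightarrow>\<^sub>L 'h) set \<Rightarrow> ('h \<Rightarrow>\<^sub>L 'h) set \<Rightarrow> real" where
  "d_KK P Q = max
     (SUP x\<in>unit_ball P. INF y\<in>unit_ball Q. norm (x - y))
     (SUP y\<in>unit_ball Q. INF x\<in>unit_ball P. norm (x - y))"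

definition d_MT ::
  "(('h::chilbert_space \<Rightarrow>\<^sub>L 'h) \<Rightarrow> complex) \<Rightarrow> ('h \<Rightarrow>\<^sub>L 'h) set \<Rightarrow> ('h \<Rightarrow>\<^sub>L 'h) set \<Rightarrow> real" where
  "d_MT \<tau> P Q = max
     (SUP x\<in>unit_ball P. INF y\<in>unit_ball Q. tau_norm \<tau> (x - y))
     (SUP y\<in>unit_ball Q. INF x\<in>unit_ball P. tau_norm \<tau> (x - y))"

end

theory Submission
  imports Defs
begin

text \<open>
  Since \<open>\<tau>\<close> is a state and \<open>x\<^sup>* x \<le> \<parallel>x\<parallel>\<^sup>2 1\<close>, we have \<open>0 \<le> \<tau>(x\<^sup>* x) \<le> \<parallel>x\<parallel>\<^sup>2\<close>, so the \<open>\<tau>\<close>-norm is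
  dominated by the operator norm. Infima and suprema over the same unit balls preserve this
  inequality. The existence of \<open>x\<^sup>*\<close> rests on the Riesz representation theorem, obtained by
  minimising \<open>z \<mapsto> \<parallel>z\<parallel>\<^sup>2 - 2 f z\<close>.
\<close>

section \<open>Riesz representation and adjoints\<close>

text \<open>By the parallelogram law a minimising sequence is Cauchy, so completeness supplies a
  minimiser; the vanishing first variation there is the claimed identity.\<close>

theorem riesz_representation:
  fixes f :: "'a::{real_inner, complete_space} \<Rightarrow> real"
  assumes "bounded_linear f"
  obtains w where "\<And>z. w \<bullet> z = f z"
proof -
  interpret f: bounded_linear f by (fact assms)
  define J where "J z = z \<bullet> z - 2 * f z" for z
  obtain K where K: "\<And>z. norm (f z) \<le> norm z * K"
    using f.bounded by blast
  \<comment> \<open>Completing the square: \<open>J z\<close> is at least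
    \<open>(norm z - K)^2 - K^2\<close>.\<close>
  have lower: "- (K\<^sup>2) \<le> J z" for z
  proof -
    have "f z \<le> norm z * K" using K[of z] by simp
    moreover have "0 \<le> (norm z - K)\<^sup>2" by simp
    ultimately show ?thesis
      by (simp add: J_def power2_diff dot_square_norm)
  qed
  define m where "m = (INF z. J z)"
  have bdd: "bdd_below (range J)" by (rule bdd_belowI2[OF lower])
  have m_le: "m \<le> J z" for z
    unfolding m_def by (rule cINF_lower[OF bdd]) simp
  have "\<exists>z. J z < m + 1 / Suc n" for n :: nat
  proof -
    have "Inf (range J) < m + 1 / Suc n" by (simp add: m_def)
    thus ?thesis using cInf_less_iff[OF _ bdd] by auto
  qed
  then obtain X where X: "\<And>n. J (X n) < m + 1 / Suc n" by metis
  \<comment> \<open>The linear terms cancel in the combination with the midpoint, where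
    \<open>J\<close> is at least \<open>m\<close>.\<close>
  have parallelogram: "(dist a b)\<^sup>2 \<le> 2 * (J a - m) + 2 * (J b - m)" for a b
  proof -
    have "(dist a b)\<^sup>2 = 2 * J a + 2 * J b - 4 * J ((1/2) *\<^sub>R (a + b))"
      unfolding J_def dist_norm
      by (simp add: f.scaleR f.add f.diff power2_norm_eq_inner inner_add inner_diff
          inner_commute field_simps)
    thus ?thesis using m_le[of "(1/2) *\<^sub>R (a + b)"] by simp
  qed
  have "Cauchy X"
  proof (rule metric_CauchyI)
    fix e :: real assume "0 < e"
    \<comment> \<open>This makes each excess over \<open>m\<close> smaller than
      \<open>e^2 / 4\<close>; counted twice each, the two add up to less than
      \<open>e^2\<close>.\<close>
    then obtain N :: nat where N: "4 / e\<^sup>2 < real N"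
      using reals_Archimedean2 by blast
    have small: "J (X n) - m < e\<^sup>2 / 4" if "N \<le> n" for n
    proof -
      have "4 / e\<^sup>2 < real (Suc n)" using N that by linarith
      hence "1 / real (Suc n) < e\<^sup>2 / 4"
        using \<open>0 < e\<close> by (simp add: field_simps)
      thus ?thesis using X[of n] by linarith
    qed
    have "dist (X i) (X j) < e" if "N \<le> i" "N \<le> j" for i j
    proof -
      have "(dist (X i) (X j))\<^sup>2 < e\<^sup>2"
        using parallelogram[of "X i" "X j"] small[OF that(1)] small[OF that(2)]
        by argo
      thus ?thesis using \<open>0 < e\<close> by (simp add: power2_less_imp_less)
    qed
    thus "\<exists>N. \<forall>i\<ge>N. \<forall>j\<ge>N. dist (X i) (X j) < e" by blast
  qed
  then obtain w where w: "X \<longlonglongrightarrow> w"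
    using Cauchy_convergent convergent_def by blast
  have "(\<lambda>n. J (X n)) \<longlonglongrightarrow> J w"
    unfolding J_def by (intro tendsto_intros w f.tendsto)
  moreover have "(\<lambda>n. m + 1 / real (Suc n)) \<longlonglongrightarrow> m + 0"
    by (intro tendsto_add tendsto_const LIMSEQ_Suc lim_1_over_n)
  ultimately have Jw: "J w \<le> m"
    using X by (intro LIMSEQ_le[of _ "J w" _ m]) (auto intro: less_imp_le)
  have "w \<bullet> z = f z" for z
  proof -
    define d where "d = w \<bullet> z - f z"
    \<comment> \<open>The right-hand side is \<open>J (w + t *\<^sub>R z) - J w\<close>.\<close>
    have expand: "0 \<le> 2 * t * d + t\<^sup>2 * (z \<bullet> z)" for t :: real
    proof -
      have "J w \<le> J (w + t *\<^sub>R z)" using Jw m_le order_trans by blast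
      thus ?thesis
        by (simp add: J_def d_def f.add f.scaleR inner_add inner_commute[of z w] power2_eq_square
            algebra_simps)
    qed
    have "0 < 1 + z \<bullet> z" by (simp add: add_pos_nonneg)
    \<comment> \<open>At \<open>t = - s\<close> the expansion equals
      \<open>- s^2 * (2 + z \<bullet> z)\<close>. The added 1 keeps the denominator positive when
      \<open>z = 0\<close>.\<close>
    define s where "s = d / (1 + z \<bullet> z)"
    have d: "d = s * (1 + z \<bullet> z)"
      using \<open>0 < 1 + z \<bullet> z\<close> by (simp add: s_def)
    have "s\<^sup>2 * (2 + z \<bullet> z) \<le> 0"
      using expand[of "- s"] by (simp add: d power2_eq_square algebra_simps)
    hence "s = 0"
      using inner_ge_zero[of z] by (auto simp: mult_le_0_iff)
    thus ?thesis using d by (simp add: d_def)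
  qed
  thus ?thesis by (rule that)
qed

text \<open>A complex number is recovered from the real parts of its multiples by 1 and -i. This
  lifts the real identities given by Riesz to \<open>cinner\<close>.\<close>

lemma cinner_eqI:
  fixes a b z w :: "'h::complex_inner"
  assumes "\<And>c. a \<bullet> (c *\<^sub>C z) = b \<bullet> (c *\<^sub>C w)"
  shows "cinner a z = cinner b w"
proof (rule complex_eqI)
  have 1: "Re (c * cinner a z) = Re (c * cinner b w)" for c
    using assms[of c] by (simp add: cinner_scaleC_right flip: Re_cinner)
  show "Re (cinner a z) = Re (cinner b w)" using 1[of 1] by simp
  show "Im (cinner a z) = Im (cinner b w)" using 1[of "- \<i>"] by simp
qed

text \<open>Riesz, applied for each \<open>x\<close> to \<open>z \<mapsto> x \<bullet> T z\<close>,
  yields a candidate; nondegeneracy of the inner product makes it unique, so the description in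
  \<open>adj\<close> denotes it.\<close>

lemma cinner_adj:
  fixes T :: "'h::chilbert_space \<Rightarrow>\<^sub>L 'h"
  assumes T: "T \<in> cblinfuns"
  shows "cinner (blinfun_apply (adj T) x) y = cinner x (blinfun_apply T y)"
proof -
  have "\<exists>w. \<forall>z. w \<bullet> z = x \<bullet> blinfun_apply T z" for x
    by (rule riesz_representation
        [OF bounded_linear_inner_right_comp[OF blinfun.bounded_linear_right]]) blast
  then obtain R where R: "\<And>x z. R x \<bullet> z = x \<bullet> blinfun_apply T z" by metis
  have "bounded_linear R"
  proof (rule bounded_linear_intro)
    show "R (x + y) = R x + R y" for x y
      by (rule vector_eq_rdot[THEN iffD1]) (simp add: R inner_add_left)
    show "R (r *\<^sub>R x) = r *\<^sub>R R x" for r x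
      by (rule vector_eq_rdot[THEN iffD1]) (simp add: R)
    show "norm (R x) \<le> norm x * norm T" for x
    proof (cases "R x = 0")
      case False
      \<comment> \<open>The identity for \<open>R\<close> is tested at \<open>z = R x\<close>; one
        factor \<open>norm (R x)\<close> is cancelled at the end.\<close>
      have "norm (R x) * norm (R x) = x \<bullet> blinfun_apply T (R x)"
        by (simp add: R[symmetric] flip: power2_eq_square power2_norm_eq_inner)
      also have "\<dots> \<le> norm x * norm (blinfun_apply T (R x))" by (rule norm_cauchy_schwarz)
      also have "\<dots> \<le> norm x * (norm T * norm (R x))"
        by (intro mult_left_mono norm_blinfun) simp
      finally show ?thesis using False by (simp flip: mult.assoc)
    qed simp
  qed
  define S where "S = Blinfun R"
  have S: "blinfun_apply S = R"
    unfolding S_def by (rule bounded_linear_Blinfun_apply) fact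
  have ex: "\<forall>x y. cinner (blinfun_apply S x) y = cinner x (blinfun_apply T y)"
  proof (intro allI cinner_eqI)
    fix x y c
    \<comment> \<open>Complex linearity of \<open>T\<close> turns \<open>c *\<^sub>C T y\<close>
      into \<open>T (c *\<^sub>C y)\<close>, to which \<open>R\<close> applies.\<close>
    show "blinfun_apply S x \<bullet> (c *\<^sub>C y) = x \<bullet> (c *\<^sub>C blinfun_apply T y)"
      using T by (simp add: S R cblinfuns_def)
  qed
  have "\<forall>x y. cinner (blinfun_apply (adj T) x) y = cinner x (blinfun_apply T y)"
    unfolding adj_def
  proof (rule theI)
    show "\<forall>x y. cinner (blinfun_apply S x) y = cinner x (blinfun_apply T y)" by (fact ex)
  next
    fix S' assume S': "\<forall>x y. cinner (blinfun_apply S' x) y = cinner x (blinfun_apply T y)"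
    show "S' = S"
    proof (rule blinfun_eqI)
      fix x
      have "blinfun_apply S' x \<bullet> y = blinfun_apply S x \<bullet> y" for y
        using S' ex by (simp flip: Re_cinner)
      thus "blinfun_apply S' x = blinfun_apply S x"
        using vector_eq_rdot by blast
    qed
  qed
  thus ?thesis by blast
qed

lemma cinner_self: "cinner x x = complex_of_real ((norm x)\<^sup>2)"
proof (rule complex_eqI)
  show "Re (cinner x x) = Re (complex_of_real ((norm x)\<^sup>2))"
    by (simp add: Re_cinner power2_norm_eq_inner)
  have "Im (cinner x x) = - Im (cinner x x)"
    by (subst cinner_commute) simp
  thus "Im (cinner x x) = Im (complex_of_real ((norm x)\<^sup>2))" by simp
qed

lemma cinner_adj_comp:
  assumes "T \<in> cblinfuns"
  shows "cinner v (blinfun_apply (adj T o\<^sub>L T) v)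
    = complex_of_real ((norm (blinfun_apply T v))\<^sup>2)"
proof -
  have "cinner v (blinfun_apply (adj T) u) = cinner (blinfun_apply T v) u" for u
    by (subst (1 2) cinner_commute) (simp add: cinner_adj[OF assms])
  thus ?thesis by (simp add: cinner_self)
qed

section \<open>The trace norm and the operator norm\<close>

text \<open>\<open>is_subalgebra\<close> speaks of sums and complex multiples, so negation is
  obtained as the multiple by -1.\<close>

lemma is_subalgebra_diff:
  assumes "is_subalgebra P M" "x \<in> P" "y \<in> P"
  shows "x - y \<in> P"
proof -
  have "scaleC_op (- 1) y = - y"
  proof (rule blinfun_eqI)
    fix v
    have "(- 1) *\<^sub>C blinfun_apply y v = (- 1) *\<^sub>R blinfun_apply y v"
      using scaleC_of_real[of "- 1"] by simp
    thus "blinfun_apply (scaleC_op (- 1) y) v = blinfun_apply (- y) v"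
      by (simp add: scaleC_op.rep_eq blinfun.minus_left)
  qed
  moreover have "x + scaleC_op (- 1) y \<in> P"
    using assms by (simp add: is_subalgebra_def)
  ultimately show ?thesis by simp
qed

lemma tau_adj_comp_bounds:
  fixes M :: "('h::chilbert_space \<Rightarrow>\<^sub>L 'h) set"
  assumes M: "von_neumann_algebra M" and \<tau>: "state_on M \<tau>" and x: "x \<in> M"
  shows "0 \<le> Re (\<tau> (adj x o\<^sub>L x))" "Re (\<tau> (adj x o\<^sub>L x)) \<le> (norm x)\<^sup>2"
proof -
  have sub: "is_subalgebra M cblinfuns"
    and MC: "M \<subseteq> cblinfuns" and one: "id_blinfun \<in> M" and adjM: "adj x \<in> M"
    using M x by (auto simp: von_neumann_algebra_def is_subalgebra_def)
  have xC: "x \<in> cblinfuns" using x MC by blast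
  define A where "A = adj x o\<^sub>L x"
  define B :: "'h \<Rightarrow>\<^sub>L 'h" where "B = scaleC_op (complex_of_real ((norm x)\<^sup>2)) id_blinfun"
  have AM: "A \<in> M" and BM: "B \<in> M"
    using sub x adjM one by (simp_all add: A_def B_def is_subalgebra_def)
  have BAM: "B - A \<in> M" using is_subalgebra_diff[OF sub BM AM] .
  have A_form: "cinner v (blinfun_apply A v)
      = complex_of_real ((norm (blinfun_apply x v))\<^sup>2)" for v
    unfolding A_def by (rule cinner_adj_comp[OF xC])
  have "positive_op A"
    using AM MC by (auto simp: positive_op_def A_form simp del: of_real_power)
  thus "0 \<le> Re (\<tau> (adj x o\<^sub>L x))"
    using \<tau> AM by (auto simp: state_on_def A_def complex_nonneg_Reals_iff)
  have "cinner v (blinfun_apply (B - A) v) \<in> \<real>\<^sub>\<ge>\<^sub>0" for v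
  proof -
    \<comment> \<open>The form is first computed as a real number, since membership in the
      nonnegative reals includes vanishing of the imaginary part.\<close>
    have "cinner v (blinfun_apply (B - A) v) + cinner v (blinfun_apply A v)
        = cinner v (blinfun_apply B v)"
      by (simp add: blinfun.diff_left flip: cinner_add_right)
    moreover have "cinner v (blinfun_apply B v) = complex_of_real ((norm x * norm v)\<^sup>2)"
      by (simp add: B_def scaleC_op.rep_eq cinner_scaleC_right cinner_self power_mult_distrib)
    ultimately have "cinner v (blinfun_apply (B - A) v)
        = complex_of_real ((norm x * norm v)\<^sup>2 - (norm (blinfun_apply x v))\<^sup>2)"
      using A_form[of v] by (simp add: algebra_simps)
    moreover have "(norm (blinfun_apply x v))\<^sup>2 \<le> (norm x * norm v)\<^sup>2"
      by (intro power_mono norm_blinfun) simp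
    ultimately show ?thesis by (simp only: nonneg_Reals_of_real_iff diff_ge_0_iff_ge)
  qed
  hence "positive_op (B - A)" using BAM MC by (auto simp: positive_op_def)
  hence "0 \<le> Re (\<tau> (B - A))"
    using \<tau> BAM by (auto simp: state_on_def complex_nonneg_Reals_iff)
  \<comment> \<open>Additivity of \<open>\<tau>\<close> is given for sums within \<open>M\<close>,
    hence the splitting of \<open>B\<close> as \<open>(B - A) + A\<close>.\<close>
  moreover have "Re (\<tau> B) = Re (\<tau> (B - A)) + Re (\<tau> A)"
  proof -
    have "\<tau> (B - A + A) = \<tau> (B - A) + \<tau> A"
      using \<tau> BAM AM unfolding state_on_def by blast
    thus ?thesis by simp
  qed
  moreover have "Re (\<tau> B) = (norm x)\<^sup>2"
    using \<tau> one by (simp add: state_on_def B_def)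
  ultimately show "Re (\<tau> (adj x o\<^sub>L x)) \<le> (norm x)\<^sup>2"
    unfolding A_def[symmetric] by linarith
qed

text \<open>\<open>sqrt\<close> is negative at negative arguments, so positivity of
  \<open>\<tau>\<close> is what provides the lower bound for the infima.\<close>

lemma tau_norm_nonneg:
  assumes "von_neumann_algebra M" "state_on M \<tau>" "x \<in> M"
  shows "0 \<le> tau_norm \<tau> x"
  using tau_adj_comp_bounds(1)[OF assms] by (simp add: tau_norm_def)

lemma tau_norm_le_norm:
  assumes "von_neumann_algebra M" "state_on M \<tau>" "x \<in> M"
  shows "tau_norm \<tau> x \<le> norm x"
  using tau_adj_comp_bounds(2)[OF assms] by (simp add: tau_norm_def real_le_lsqrt)

text \<open>Real infima and suprema are monotone only under boundedness: 0 bounds the inner families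
  below, and the single point \<open>b\<close> bounds the outer family of \<open>g\<close> above by
  \<open>C\<close>.\<close>

lemma SUP_INF_mono:
  fixes f g :: "'a \<Rightarrow> 'b \<Rightarrow> real"
  assumes "A \<noteq> {}" "b \<in> B"
    and "\<And>x y. x \<in> A \<Longrightarrow> y \<in> B \<Longrightarrow> 0 \<le> f x y"
    and le: "\<And>x y. x \<in> A \<Longrightarrow> y \<in> B \<Longrightarrow> f x y \<le> g x y"
    and bound: "\<And>x. x \<in> A \<Longrightarrow> g x b \<le> C"
  shows "(SUP x\<in>A. INF y\<in>B. f x y) \<le> (SUP x\<in>A. INF y\<in>B. g x y)"
proof (rule cSUP_mono)
  have below: "bdd_below (f x ` B)" "bdd_below (g x ` B)" if "x \<in> A" for x
    using assms(3) order_trans[OF assms(3) le] that by (auto intro!: bdd_belowI2[of _ 0])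
  show "bdd_above ((\<lambda>x. INF y\<in>B. g x y) ` A)"
  proof (rule bdd_aboveI2)
    show "(INF y\<in>B. g x y) \<le> C" if "x \<in> A" for x
      using cINF_lower[OF below(2)[OF that] \<open>b \<in> B\<close>] bound[OF that] by linarith
  qed
  show "\<exists>a'\<in>A. (INF y\<in>B. f x y) \<le> (INF y\<in>B. g a' y)" if "x \<in> A" for x
    using that \<open>b \<in> B\<close> below(1) le by (intro bexI[of _ x] cINF_mono) auto
qed fact

theorem lemma5p6:
  fixes M P Q :: "('h::chilbert_space \<Rightarrow>\<^sub>L 'h) set"
    and \<tau> :: "('h \<Rightarrow>\<^sub>L 'h) \<Rightarrow> complex"
  assumes "von_neumann_algebra M"
    and "state_on M \<tau>"
    and "faithful_on M \<tau>"
    and "normal_on M \<tau>"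
    and "tracial_on M \<tau>"
    and "is_subalgebra P M"
    and "is_subalgebra Q M"
  shows "d_MT \<tau> P Q \<le> d_KK P Q"
proof -
  have sub: "is_subalgebra M cblinfuns"
    using assms(1) by (simp add: von_neumann_algebra_def)
  have zero: "0 \<in> unit_ball P" "0 \<in> unit_ball Q"
    using assms(6,7) by (simp_all add: unit_ball_def is_subalgebra_def)
  have diff: "x - y \<in> M" if "x \<in> unit_ball P" "y \<in> unit_ball Q" for x y
    using that assms(6,7) is_subalgebra_diff[OF sub]
    by (auto simp: unit_ball_def is_subalgebra_def)
  note nonneg = tau_norm_nonneg[OF assms(1,2) diff]
  note le = tau_norm_le_norm[OF assms(1,2) diff]
  show ?thesis
    unfolding d_MT_def d_KK_def
  proof (rule max.mono)
    \<comment> \<open>The point 0 lies in both balls and has distance at most 1 to every element,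
      whence \<open>b = 0\<close> and \<open>C = 1\<close>.\<close>
    show "(SUP x\<in>unit_ball P. INF y\<in>unit_ball Q. tau_norm \<tau> (x - y))
        \<le> (SUP x\<in>unit_ball P. INF y\<in>unit_ball Q. norm (x - y))"
      using zero nonneg le by (intro SUP_INF_mono[where b = 0 and C = 1]) (auto simp: unit_ball_def)
    show "(SUP y\<in>unit_ball Q. INF x\<in>unit_ball P. tau_norm \<tau> (x - y))
        \<le> (SUP y\<in>unit_ball Q. INF x\<in>unit_ball P. norm (x - y))"
      using zero nonneg le by (intro SUP_INF_mono[where b = 0 and C = 1]) (auto simp: unit_ball_def)
  qed
qed

end
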